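(* If a graph $G$ has the *-C1P, then $\operatorname{pe}(G)\le 1$.
   Context: All graphs are finite and simple; the notion $\operatorname{pe}(G)$ is used for connected graphs $G$. A graph $G$ has the partially augmented consecutive ones property ( *-C1P) if there is a linear ordering of $V(G)$ such that for every vertex $u$, at least one of the open neighborhood $N(u)$ or the closed neighborhood $N[u]$ forms a set of consecutive vertices in this ordering. For a connected graph $G$ and a path $P$ in $G$, the eccentricity of $P$ is the maximum over all vertices $v$ of $G$ of the distance from $v$ to $V(P)$; $\operatorname{pe}(G)$ is the minimum eccentricity of a path in $G$. *)

theory Defs
  imports
    "Graph_Theory.Digraph_Component"
    "Graph_Theory.Vertex_Walk"
    "Graph_Theory.Shortest_Path"
begin

definition open_nbhd :: "('a, 'b) pre_digraph \<Rightarrow> 'a \<Rightarrow> 'a set" where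
  "open_nbhd G u = {v \<in> verts G. u \<rightarrow>\<^bsub>G\<^esub> v}"

definition closed_nbhd :: "('a, 'b) pre_digraph \<Rightarrow> 'a \<Rightarrow> 'a set" where
  "closed_nbhd G u = insert u (open_nbhd G u)"

definition consecutive_in :: "'a set \<Rightarrow> 'a rel \<Rightarrow> 'a set \<Rightarrow> bool" where
  "consecutive_in V r S \<longleftrightarrow>
     S \<subseteq> V \<and> (\<forall>x\<in>S. \<forall>z\<in>S. \<forall>y\<in>V. (x, y) \<in> r \<and> (y, z) \<in> r \<longrightarrow> y \<in> S)"

definition star_C1P :: "('a, 'b) pre_digraph \<Rightarrow> bool" where
  "star_C1P G \<longleftrightarrow>
     (\<exists>r. linear_order_on (verts G) r \<and>
        (\<forall>u\<in>verts G. consecutive_in (verts G) r (open_nbhd G u) \<or>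
                      consecutive_in (verts G) r (closed_nbhd G u)))"

text \<open>The usual graph distance is the shortest-walk cost with all arc weights equal to 1;
  it is extended-real valued, with value \<open>\<infinity>\<close> for unreachable vertices.\<close>

definition graph_dist :: "('a, 'b) pre_digraph \<Rightarrow> 'a \<Rightarrow> 'a \<Rightarrow> ereal" where
  "graph_dist G u v = wf_digraph.\<mu> G (\<lambda>_. 1) u v"

definition path_ecc :: "('a, 'b) pre_digraph \<Rightarrow> 'a list \<Rightarrow> ereal" where
  "path_ecc G p = Max ((\<lambda>v. Min (graph_dist G v ` set p)) ` verts G)"

text \<open>A path is a nonempty list of distinct vertices, so a single vertex is a path. The
  minimum below is meaningful because a finite graph has finitely many paths.\<close>

definition pe :: "('a, 'b) pre_digraph \<Rightarrow> ereal" where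
  "pe G = Min (path_ecc G ` {p. vpath p G})"

lemma finite_vpaths:
  assumes "finite (verts G)"
  shows "finite {p. vpath p G}"
proof (rule finite_subset)
  show "{p. vpath p G} \<subseteq> {p. set p \<subseteq> verts G \<and> length p \<le> card (verts G)}"
    using assms by (auto simp: vpath_def vwalk_def distinct_card[symmetric] intro: card_mono)
  show "finite {p. set p \<subseteq> verts G \<and> length p \<le> card (verts G)}"
    using assms by (rule finite_lists_length_le)
qed

end

theory Submission
  imports Defs
begin

text \<open>Let \<open>X\<close> be a smallest connected dominating set. Every vertex \<open>y\<close> of \<open>X\<close> whose removal leaves
  \<open>X\<close> connected has a private neighbour \<open>y'\<close> outside \<open>X\<close>. If \<open>y'\<close> lies, in the *-C1P ordering,
  between the private neighbours of two other such vertices, then every edge at a vertex of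
  \<open>X - {y}\<close> jumps over \<open>y'\<close>. Hence \<open>X\<close> has at most four non-cut vertices, and if it has at least
  three, then a vertex of \<open>X\<close> is adjacent to everything lying between two of its neighbours.

  Suppose that a longest path \<open>P\<close> of \<open>X\<close> misses a vertex \<open>t \<in> X\<close> adjacent to \<open>c \<in> P\<close>. Of the three
  branches leaving \<open>c\<close>, two have their second vertices on the same side of \<open>c\<close>, which yields a chord
  around a neighbour of \<open>c\<close> on \<open>P\<close>; repeating this one step further along \<open>P\<close> yields a chord around
  the next vertex. These two vertices, the ends of \<open>P\<close> and \<open>t\<close> are five non-cut vertices of
  \<open>P \<union> {t}\<close>, and each of them gives rise to a different non-cut vertex of \<open>X\<close>, a contradiction.
  So \<open>X\<close> is spanned by a path.\<close>

section \<open>Connectedness of vertex sets and their non-cut vertices\<close>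

locale adjacency =
  fixes V :: "'a set" and E :: "'a \<Rightarrow> 'a \<Rightarrow> bool"
  assumes finite_V: "finite V"
    and E_sym: "E x y \<Longrightarrow> E y x"
    and E_irrefl: "\<not> E x x"
    and E_in_V: "E x y \<Longrightarrow> x \<in> V"
begin

text \<open>Connectedness of the subgraph induced on \<open>Z\<close>, encoded by sets closed under
  adjacency so that no walks occur; the empty set counts as connected.\<close>

definition conn :: "'a set \<Rightarrow> bool" where
  "conn Z \<longleftrightarrow> (\<forall>A\<subseteq>Z. A \<noteq> {} \<longrightarrow> (\<forall>a\<in>A. \<forall>b\<in>Z. E a b \<longrightarrow> b \<in> A) \<longrightarrow> A = Z)"

lemma connD:
  "\<lbrakk>conn Z; A \<subseteq> Z; A \<noteq> {}; \<And>a b. \<lbrakk>a \<in> A; b \<in> Z; E a b\<rbrakk> \<Longrightarrow> b \<in> A\<rbrakk> \<Longrightarrow> A = Z"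
  unfolding conn_def by blast

lemma not_connE:
  assumes "\<not> conn Z"
  obtains A where "A \<subseteq> Z" "A \<noteq> {}" "A \<noteq> Z" "\<And>a b. \<lbrakk>a \<in> A; b \<in> Z; E a b\<rbrakk> \<Longrightarrow> b \<in> A"
  using assms unfolding conn_def by blast

lemma conn_singleton: "conn {x}"
  unfolding conn_def by auto

lemma conn_Un:
  assumes A: "conn A" and B: "conn B" and "a \<in> A" "b \<in> B" "E a b"
  shows "conn (A \<union> B)"
  unfolding conn_def
proof (intro allI impI)
  fix C assume C: "C \<subseteq> A \<union> B" "C \<noteq> {}" and cl: "\<forall>x\<in>C. \<forall>y\<in>A \<union> B. E x y \<longrightarrow> y \<in> C"
  have 1: "C \<inter> A = {} \<or> C \<inter> A = A"
    using connD[OF A, of "C \<inter> A"] cl by blast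
  have 2: "C \<inter> B = {} \<or> C \<inter> B = B"
    using connD[OF B, of "C \<inter> B"] cl by blast
  have 3: "a \<in> C \<longleftrightarrow> b \<in> C"
    using cl assms(3-5) E_sym by blast
  show "C = A \<union> B" using 1 2 3 C assms(3,4) by blast
qed

lemma conn_insert: "\<lbrakk>conn A; a \<in> A; E a b\<rbrakk> \<Longrightarrow> conn (insert b A)"
  using conn_Un[OF _ conn_singleton, of A a b b] by simp

lemma conn_path: "successively E p \<Longrightarrow> conn (set p)"
proof (induction p rule: induct_list012)
  case (3 x y zs)
  then have "conn (set (y # zs))" "E y x" using E_sym by auto
  then show ?case using conn_insert[of "set (y # zs)" y x] by simp
qed (auto simp: conn_def)

lemma conn_neighbour:
  assumes "conn Z" "x \<in> Z" "Z \<noteq> {x}"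
  obtains y where "y \<in> Z" "E x y"
  using connD[OF assms(1), of "{x}"] assms(2,3) by blast

text \<open>A component of \<open>X - {f}\<close> attaches to the rest of \<open>X\<close> only at \<open>f\<close>; a cut vertex inside it
  cuts off a strictly smaller component.\<close>

lemma noncut_in_branch:
  assumes "conn X" "finite X" "f \<in> X" "K \<subseteq> X - {f}" "K \<noteq> {}"
    "\<And>a b. \<lbrakk>a \<in> K; b \<in> X - {f}; E a b\<rbrakk> \<Longrightarrow> b \<in> K"
  shows "\<exists>y\<in>K. conn (X - {y})"
  using assms(3-6)
proof (induction "card K" arbitrary: f K rule: less_induct)
  case less
  obtain y where y: "y \<in> K" using less.prems by blast
  show ?case
  proof (cases "conn (X - {y})")
    case False
    then obtain A where A: "A \<subseteq> X - {y}" "A \<noteq> {}" "A \<noteq> X - {y}"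
      "\<And>a b. \<lbrakk>a \<in> A; b \<in> X - {y}; E a b\<rbrakk> \<Longrightarrow> b \<in> A" by (rule not_connE) blast
    \<comment> \<open>Of the two sides of the cut at \<open>y\<close>, take the one that misses
      \<open>f\<close>.\<close>
    obtain K' where K': "K' \<subseteq> X - {y}" "K' \<noteq> {}" "f \<notin> K'"
      "\<And>a b. \<lbrakk>a \<in> K'; b \<in> X - {y}; E a b\<rbrakk> \<Longrightarrow> b \<in> K'"
    proof (cases "f \<in> A")
      case True
      have "b \<in> X - {y} - A" if "a \<in> X - {y} - A" "b \<in> X - {y}" "E a b" for a b
        using that A(4)[of b a] E_sym[of a b] by blast
      then show ?thesis using that[of "X - {y} - A"] A(1,3) True by blast
    next
      case False
      then show ?thesis using that[of A] A by blast
    qed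
    \<comment> \<open>\<open>K' - K\<close> is closed in \<open>X\<close>: its vertices differ from
      \<open>f\<close>, so they have no neighbour in \<open>K\<close>, and \<open>y\<close> lies in
      \<open>K\<close>. But it misses \<open>f\<close>.\<close>
    have "K' - K = {}"
    proof (rule ccontr)
      assume "K' - K \<noteq> {}"
      then have "K' - K = X"
      proof (rule connD[OF assms(1), rotated])
        fix a b assume ab: "a \<in> K' - K" "b \<in> X" "E a b"
        then have "a \<in> X - {f}" using K' by blast
        then have "b \<notin> K" using less.prems(4)[of b a] ab E_sym by blast
        then show "b \<in> K' - K" using K'(4)[of a b] ab y by blast
      qed (use K' in blast)
      then show False using K'(3) less.prems(1) by blast
    qed
    then have sub: "K' \<subset> K" using y K'(1) by blast
    have "finite K" using less.prems(2) assms(2) finite_subset by blast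
    then have "card K' < card K" using sub psubset_card_mono by blast
    then have "\<exists>z\<in>K'. conn (X - {z})"
      using less.hyps[of K' y] y less.prems(2) K' by blast
    then show ?thesis using sub by blast
  qed (use y in blast)
qed

text \<open>Turns a non-cut vertex \<open>f\<close> of \<open>W\<close> into one of
  \<open>X\<close>: if \<open>f\<close> cuts \<open>X\<close>, the connected set
  \<open>W - {f}\<close> stays on one side of a cut, and the other side \<open>K\<close> contains a
  non-cut vertex of \<open>X\<close>.\<close>

lemma branch_at_noncut:
  assumes X: "conn X" "finite X" "W \<subseteq> X" and f: "f \<in> W" "conn (W - {f})"
  shows "\<exists>K y. K \<subseteq> X - W \<and> (\<forall>a\<in>K. \<forall>b\<in>X. E a b \<longrightarrow> b \<in> K \<or> b = f) \<and>
           y \<in> X \<and> conn (X - {y}) \<and> (y = f \<and> K = {} \<or> y \<in> K)"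
proof (cases "conn (X - {f})")
  case True
  then show ?thesis using assms by (intro exI[of _ "{}"] exI[of _ f]) auto
next
  case False
  then obtain A where A: "A \<subseteq> X - {f}" "A \<noteq> {}" "A \<noteq> X - {f}"
    "\<And>a b. \<lbrakk>a \<in> A; b \<in> X - {f}; E a b\<rbrakk> \<Longrightarrow> b \<in> A" by (rule not_connE) blast
  have W: "A \<inter> (W - {f}) = {} \<or> A \<inter> (W - {f}) = W - {f}"
    using connD[OF f(2), of "A \<inter> (W - {f})"] A(4) X(3) by blast
  obtain K where K: "K \<subseteq> X - {f}" "K \<noteq> {}" "K \<inter> W = {}"
      "\<And>a b. \<lbrakk>a \<in> K; b \<in> X - {f}; E a b\<rbrakk> \<Longrightarrow> b \<in> K"
  proof (cases "A \<inter> (W - {f}) = {}")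
    case True
    then show ?thesis using that[of A] A by blast
  next
    case False
    have "b \<in> X - {f} - A" if "a \<in> X - {f} - A" "b \<in> X - {f}" "E a b" for a b
      using that A(4)[of b a] E_sym[of a b] by blast
    moreover have "W - {f} \<subseteq> A" using False W by blast
    ultimately show ?thesis using that[of "X - {f} - A"] A(1,3) by blast
  qed
  have "f \<in> X" using f X by blast
  then have "\<exists>y\<in>K. conn (X - {y})"
    using K by (intro noncut_in_branch[OF X(1,2)])
  then obtain y where "y \<in> K" "conn (X - {y})" by blast
  then show ?thesis using K by (intro exI[of _ K] exI[of _ y]) blast
qed

end

text \<open>Consecutiveness of \<open>N(u)\<close> or of \<open>N[u]\<close> enters only through \<open>between\<close>.\<close>

locale interval_adjacency = adjacency V E
  for V :: "'a set" and E :: "'a \<Rightarrow> 'a \<Rightarrow> bool" +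
  fixes pos :: "'a \<Rightarrow> nat"
  assumes pos_inj: "inj_on pos V"
    and between: "\<lbrakk>E u x; E u z; y \<in> V; pos x < pos y; pos y < pos z\<rbrakk> \<Longrightarrow> E u y \<or> y = u"

section \<open>Private neighbours of a smallest connected dominating set\<close>

text \<open>\<open>private_ex\<close> is the form in which minimality of a connected dominating set
  enters: dropping \<open>y\<close> without disconnecting \<open>X\<close> leaves some vertex
  undominated.\<close>

locale private_neighbours = interval_adjacency V E pos
  for V :: "'a set" and E :: "'a \<Rightarrow> 'a \<Rightarrow> bool" and pos :: "'a \<Rightarrow> nat" +
  fixes X :: "'a set"
  assumes X_sub: "X \<subseteq> V" and X_conn: "conn X"
    and private_ex: "\<lbrakk>y \<in> X; conn (X - {y})\<rbrakk> \<Longrightarrow> \<exists>v\<in>V - X. \<forall>x\<in>X. E v x \<longleftrightarrow> x = y"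
begin

definition noncut :: "'a set" where
  "noncut = {y \<in> X. conn (X - {y})}"

definition priv :: "'a \<Rightarrow> 'a" where
  "priv y = (SOME v. v \<in> V - X \<and> (\<forall>x\<in>X. E v x \<longleftrightarrow> x = y))"

lemma priv:
  assumes "y \<in> noncut"
  shows "priv y \<in> V" "priv y \<notin> X" "x \<in> X \<Longrightarrow> E (priv y) x \<longleftrightarrow> x = y" "E y (priv y)"
proof -
  have y: "y \<in> X" "conn (X - {y})" using assms by (auto simp: noncut_def)
  then have ex: "\<exists>v. v \<in> V - X \<and> (\<forall>x\<in>X. E v x \<longleftrightarrow> x = y)"
    using private_ex by blast
  have *: "priv y \<in> V - X \<and> (\<forall>x\<in>X. E (priv y) x \<longleftrightarrow> x = y)"
    using someI_ex[OF ex] unfolding priv_def .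
  then show "priv y \<in> V" "priv y \<notin> X" "x \<in> X \<Longrightarrow> E (priv y) x \<longleftrightarrow> x = y" by auto
  show "E y (priv y)" using * y(1) E_sym[of "priv y" y] by blast
qed

lemma finite_X: "finite X"
  using X_sub finite_V finite_subset by blast

lemma finite_noncut: "finite noncut"
  unfolding noncut_def using finite_X by simp

lemma inj_on_pos_priv: "inj_on (\<lambda>y. pos (priv y)) noncut"
proof (rule inj_onI)
  fix x y assume xy: "x \<in> noncut" "y \<in> noncut" "pos (priv x) = pos (priv y)"
  then have "priv x = priv y" using inj_onD[OF pos_inj] priv(1) by blast
  moreover have "y \<in> X" using xy by (simp add: noncut_def)
  ultimately show "x = y" using priv(3)[OF xy(1), of y] priv(3)[OF xy(2), of y] by metis
qed

section \<open>Crossing edges and the number of non-cut vertices\<close>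

text \<open>\<open>priv y\<close> has no neighbour in \<open>X - {y}\<close>, so by
  \<open>between\<close> the neighbours of any vertex there all lie on one side of
  \<open>priv y\<close>. Thus crossing spreads along the edges of the connected set
  \<open>X - {y}\<close>, and some edge crosses because \<open>priv x\<close> and
  \<open>priv z\<close> lie on different sides.\<close>

lemma edges_cross_priv:
  assumes nc: "x \<in> noncut" "y \<in> noncut" "z \<in> noncut"
    and lt: "pos (priv x) < pos (priv y)" "pos (priv y) < pos (priv z)"
    and b: "b \<in> X" "b \<noteq> y" "E b d"
  shows "pos b < pos (priv y) \<and> pos (priv y) < pos d \<or> pos d < pos (priv y) \<and> pos (priv y) < pos b"
proof -
  let ?m = "pos (priv y)"
  define cross where "cross b d \<longleftrightarrow> pos b < ?m \<and> ?m < pos d \<or> pos d < ?m \<and> ?m < pos b" for b d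
  have ne: "pos v \<noteq> ?m" if "v \<in> V" "v \<noteq> priv y" for v
    using inj_onD[OF pos_inj, of v "priv y"] that priv(1)[OF nc(2)] by blast
  have nadj: "\<not> E b (priv y) \<and> b \<noteq> priv y" if "b \<in> X - {y}" for b
    using that priv[OF nc(2)] E_sym by blast
  have neX: "pos b \<noteq> ?m" if "b \<in> X" for b
    using that ne priv(2)[OF nc(2)] X_sub by blast
  have same: "cross b d'" if "b \<in> X - {y}" "cross b d" "E b d" "E b d'" for b d d'
  proof -
    have "d' \<noteq> priv y" using nadj[OF that(1)] that(4) by blast
    then have "pos d' \<noteq> ?m" using ne E_in_V E_sym that(4) by blast
    then show ?thesis
      using between[OF that(3,4) priv(1)[OF nc(2)]] between[OF that(4,3) priv(1)[OF nc(2)]]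
        nadj[OF that(1)] that(2) unfolding cross_def by (metis linorder_neqE_nat)
  qed
  have conn: "conn (X - {y})" using nc(2) by (simp add: noncut_def)
  have xz: "x \<in> X - {y}" "z \<in> X - {y}" using nc lt by (auto simp: noncut_def)
  let ?C = "{b \<in> X - {y}. \<exists>d. E b d \<and> cross b d}"
  have "?C \<noteq> {}"
  proof
    assume none: "?C = {}"
    \<comment> \<open>Without crossing, \<open>x\<close> lies on the side of \<open>priv x\<close>
      and \<open>z\<close> on that of \<open>priv z\<close>, yet no edge inside
      \<open>X - {y}\<close> leaves the left side.\<close>
    let ?A = "{b \<in> X - {y}. pos b < ?m}"
    have "pos x < ?m" using none xz priv(4)[OF nc(1)] lt neX[of x] unfolding cross_def by fastforce
    moreover have "?m < pos z" using none xz priv(4)[OF nc(3)] lt neX[of z] unfolding cross_def by fastforce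
    moreover have "?A = X - {y}"
    proof (rule connD[OF conn])
      show "?A \<noteq> {}" using \<open>pos x < ?m\<close> xz by blast
      fix a b assume "a \<in> ?A" "b \<in> X - {y}" "E a b"
      then show "b \<in> ?A" using none neX[of b] unfolding cross_def by fastforce
    qed blast
    ultimately show False using xz(2) by (metis (mono_tags, lifting) mem_Collect_eq order_less_asym)
  qed
  then have "?C = X - {y}"
  proof (rule connD[OF conn, rotated])
    fix a b assume ab: "a \<in> ?C" "b \<in> X - {y}" "E a b"
    then have "cross a b" using same by blast
    then have "cross b a" unfolding cross_def by blast
    then show "b \<in> ?C" using ab E_sym by blast
  qed blast
  then show ?thesis using same b unfolding cross_def by blast
qed

lemma three_noncut_ordered:
  assumes "3 \<le> card noncut"
  obtains x y z where "x \<in> noncut" "y \<in> noncut" "z \<in> noncut"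
    "pos (priv x) < pos (priv y)" "pos (priv y) < pos (priv z)"
proof -
  let ?l = "sorted_list_of_set ((\<lambda>y. pos (priv y)) ` noncut)"
  have len: "length ?l = card noncut" using card_image[OF inj_on_pos_priv] by simp
  have st: "sorted_wrt (<) ?l" by simp
  have mem: "\<exists>y\<in>noncut. pos (priv y) = ?l ! i" if "i < 3" for i
    using nth_mem[of i ?l] that len assms finite_noncut by fastforce
  have "?l ! 0 < ?l ! 1" "?l ! 1 < ?l ! 2"
    using sorted_wrt_nth_less[OF st] len assms by auto
  then show thesis using that mem[of 0] mem[of 1] mem[of 2] by fastforce
qed

text \<open>Sort five non-cut vertices by their private neighbours. The edge from the third one,
  \<open>y3\<close>, to \<open>priv y3\<close> must jump over both \<open>priv y2\<close> and
  \<open>priv y4\<close>, which puts \<open>y3\<close> left of \<open>priv y2\<close> and also right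
  of \<open>priv y4\<close>.\<close>

lemma card_noncut_le: "card noncut \<le> 4"
proof (rule ccontr)
  assume "\<not> card noncut \<le> 4"
  then have c: "5 \<le> card noncut" by simp
  let ?l = "sorted_list_of_set ((\<lambda>y. pos (priv y)) ` noncut)"
  have len: "length ?l = card noncut" using card_image[OF inj_on_pos_priv] by simp
  have st: "sorted_wrt (<) ?l" by simp
  have mem: "\<exists>y\<in>noncut. pos (priv y) = ?l ! i" if "i < 5" for i
    using nth_mem[of i ?l] that len c finite_noncut by fastforce
  have lt: "?l ! 0 < ?l ! 1" "?l ! 1 < ?l ! 2" "?l ! 2 < ?l ! 3" "?l ! 3 < ?l ! 4"
    using sorted_wrt_nth_less[OF st] len c by auto
  obtain y1 y2 y3 y4 y5 where y: "y1 \<in> noncut" "y2 \<in> noncut" "y3 \<in> noncut" "y4 \<in> noncut" "y5 \<in> noncut"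
    and p: "pos (priv y1) = ?l ! 0" "pos (priv y2) = ?l ! 1" "pos (priv y3) = ?l ! 2"
      "pos (priv y4) = ?l ! 3" "pos (priv y5) = ?l ! 4"
    using mem[of 0] mem[of 1] mem[of 2] mem[of 3] mem[of 4] by auto
  have *: "y3 \<in> X" "y3 \<noteq> y2" "y3 \<noteq> y4" "E y3 (priv y3)"
    using y(3) p lt priv(4) by (auto simp: noncut_def)
  have "pos y3 < pos (priv y2)"
    using edges_cross_priv[OF y(1,2,5) _ _ *(1,2,4)] p lt by linarith
  moreover have "pos (priv y4) < pos y3"
    using edges_cross_priv[OF y(1,4,5) _ _ *(1,3,4)] p lt by linarith
  ultimately show False using p lt by linarith
qed

text \<open>By \<open>between\<close> it is enough that \<open>t\<close> itself does not lie between
  \<open>a\<close> and \<open>b\<close>. Its edges to both jump over the middle private neighbour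
  \<open>priv y\<close>, so \<open>a\<close> and \<open>b\<close> lie on the same side of
  \<open>t\<close>.\<close>

lemma strictly_between_adjacent:
  assumes c: "3 \<le> card noncut" and t: "t \<in> X" "E t a" "E t b"
    and ab: "a \<in> X \<union> priv ` noncut" "b \<in> X \<union> priv ` noncut"
    and x: "x \<in> V" "pos a < pos x" "pos x < pos b"
  shows "E t x"
proof -
  obtain u y w where nc: "u \<in> noncut" "y \<in> noncut" "w \<in> noncut"
    and lt: "pos (priv u) < pos (priv y)" "pos (priv y) < pos (priv w)"
    using three_noncut_ordered[OF c] .
  note cross = edges_cross_priv[OF nc lt]
  have "\<not> (pos a < pos t \<and> pos t < pos b)"
  proof (cases "t = y")
    case False
    then show ?thesis using cross[OF t(1) False t(2)] cross[OF t(1) False t(3)] by linarith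
  next
    case True
    have side: "d = priv y \<or> pos t < pos (priv y) \<and> pos (priv y) < pos d \<or> pos d < pos (priv y) \<and> pos (priv y) < pos t"
      if d: "E t d" "d \<in> X \<union> priv ` noncut" for d
    proof (cases "d \<in> X")
      case True
      then show ?thesis using cross[of d t] d \<open>t = y\<close> E_sym E_irrefl by blast
    next
      case False
      then obtain v where "v \<in> noncut" "d = priv v" using d by blast
      then show ?thesis using priv(3)[of v t] d t(1) E_sym True by blast
    qed
    show ?thesis using side[OF t(2) ab(1)] side[OF t(3) ab(2)] by auto
  qed
  then show ?thesis using between[OF t(2,3) x] x by auto
qed

section \<open>Tails and non-cut vertices of subsets of \<open>X\<close>\<close>

definition tail_vertex :: "'a set \<Rightarrow> 'a \<Rightarrow> 'a \<Rightarrow> bool" where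
  "tail_vertex W f s \<longleftrightarrow> s \<in> X \<union> priv ` noncut \<and> s \<notin> W \<and> (\<forall>w\<in>W. E s w \<longleftrightarrow> w = f)"

text \<open>If the branch at \<open>f\<close> is empty, then \<open>f\<close> is a non-cut vertex of
  \<open>X\<close> and \<open>priv f\<close> serves; a nonempty branch contains a neighbour of
  \<open>f\<close>, as \<open>X\<close> is connected.\<close>

lemma tail_vertex_ex:
  assumes W: "W \<subseteq> X" and f: "f \<in> W" "conn (W - {f})"
  shows "\<exists>s. tail_vertex W f s"
proof -
  obtain K y where K: "K \<subseteq> X - W" "\<And>a b. \<lbrakk>a \<in> K; b \<in> X; E a b\<rbrakk> \<Longrightarrow> b \<in> K \<or> b = f"
    and y: "y \<in> X" "conn (X - {y})" "y = f \<and> K = {} \<or> y \<in> K"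
    using branch_at_noncut[OF X_conn finite_X W f] by blast
  show ?thesis
  proof (cases "K = {}")
    case True
    then have "f \<in> noncut" using y by (auto simp: noncut_def)
    then show ?thesis using priv[of f] W unfolding tail_vertex_def by blast
  next
    case False
    have "\<exists>s\<in>K. E s f"
    proof (rule ccontr)
      assume "\<not> (\<exists>s\<in>K. E s f)"
      then have "K = X" using connD[OF X_conn, of K] K False by blast
      then show False using K(1) W f(1) by blast
    qed
    then show ?thesis using K W unfolding tail_vertex_def by blast
  qed
qed

text \<open>Send each \<open>f\<close> to a non-cut vertex of \<open>X\<close> in its branch, or to
  \<open>f\<close> itself. This is injective: branches at distinct \<open>f\<close> and
  \<open>g\<close> avoid \<open>W\<close>, so their intersection has no exit in \<open>X\<close>
  and, if nonempty, would be all of \<open>X\<close>.\<close>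

lemma card_noncut_subgraph_le:
  assumes W: "W \<subseteq> X" and F: "F \<subseteq> W" "\<And>f. f \<in> F \<Longrightarrow> conn (W - {f})"
  shows "card F \<le> card noncut"
proof -
  define branch where "branch f y K \<longleftrightarrow> K \<subseteq> X - W \<and>
      (\<forall>a\<in>K. \<forall>b\<in>X. E a b \<longrightarrow> b \<in> K \<or> b = f) \<and>
      y \<in> noncut \<and> (y = f \<and> K = {} \<or> y \<in> K)" for f y K
  have "\<exists>K y. branch f y K" if "f \<in> F" for f
    using branch_at_noncut[OF X_conn finite_X W, of f] F that
    unfolding branch_def noncut_def by auto
  then have "\<forall>f\<in>F. \<exists>y. \<exists>K. branch f y K" by blast
  then obtain y where "\<forall>f\<in>F. \<exists>K. branch f (y f) K" by (rule bchoice[THEN exE])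
  then obtain K where br: "\<forall>f\<in>F. branch f (y f) (K f)" by (rule bchoice[THEN exE])
  have K: "\<And>f. f \<in> F \<Longrightarrow> K f \<subseteq> X - W"
      "\<And>f a b. \<lbrakk>f \<in> F; a \<in> K f; b \<in> X; E a b\<rbrakk> \<Longrightarrow> b \<in> K f \<or> b = f"
    and y: "\<And>f. f \<in> F \<Longrightarrow> y f \<in> noncut" "\<And>f. f \<in> F \<Longrightarrow> y f = f \<and> K f = {} \<or> y f \<in> K f"
    using br unfolding branch_def by simp_all
  have "inj_on y F"
  proof (rule inj_onI, rule ccontr)
    fix f g assume fg: "f \<in> F" "g \<in> F" "y f = y g" "f \<noteq> g"
    have W': "f \<in> W" "g \<in> W" using fg F by auto
    have "y f \<in> K f \<inter> K g"
      using y(2)[OF fg(1)] y(2)[OF fg(2)] fg(3,4) K(1)[OF fg(1)] K(1)[OF fg(2)] W' by auto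
    then have "K f \<inter> K g = X"
      using connD[OF X_conn, of "K f \<inter> K g"] K(1)[OF fg(1)] K(1)[OF fg(2)] K(2) fg W' by blast
    then show False using K(1)[OF fg(1)] W' W by blast
  qed
  then show ?thesis using card_inj_on_le[OF _ _ finite_noncut] y(1) by blast
qed


section \<open>Longest paths in \<open>X\<close>\<close>

definition xpath :: "'a list \<Rightarrow> bool" where
  "xpath p \<longleftrightarrow> distinct p \<and> successively E p \<and> set p \<subseteq> X"

lemma successively_flip: "successively (\<lambda>x y. E y x) p \<longleftrightarrow> successively E p"
  by (induction p rule: induct_list012) (auto intro: E_sym)

lemma xpath_rev: "xpath (rev p) \<longleftrightarrow> xpath p"
  by (simp add: xpath_def successively_flip)

text \<open>Writing the path as \<open>rev L @ c # R\<close> lists both arms outwards from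
  \<open>c\<close>: the ends are \<open>last L\<close> and \<open>last R\<close>, and reversal swaps
  the arms.\<close>

lemma conn_branched_minus_end:
  assumes p: "xpath (rev L @ c # R)" and t: "t \<notin> set (rev L @ c # R)" "E t c" and R: "R \<noteq> []"
  shows "conn (insert t (set (rev L @ c # R)) - {last R})"
proof -
  let ?q = "rev L @ c # butlast R"
  have q: "rev L @ c # R = ?q @ [last R]" using R by simp
  then have "distinct (?q @ [last R])" "successively E (?q @ [last R])"
    using p unfolding xpath_def by metis+
  then have "last R \<notin> set ?q" "successively E ?q"
    using successively_append_iff[of E ?q] by auto
  then have "last R \<notin> set ?q" "conn (set ?q)" using conn_path by blast+
  moreover have "last R \<noteq> t" using t R by auto
  ultimately have "insert t (set (rev L @ c # R)) - {last R} = insert t (set ?q)"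
    unfolding q by auto
  then show ?thesis using conn_insert[OF \<open>conn (set ?q)\<close>, of c t] t(2) E_sym by auto
qed

lemma conn_branched_minus_other_end:
  assumes p: "xpath (rev L @ c # R)" and t: "t \<notin> set (rev L @ c # R)" "E t c" and L: "L \<noteq> []"
  shows "conn (insert t (set (rev L @ c # R)) - {last L})"
proof -
  have "xpath (rev R @ c # L)" using p xpath_rev[of "rev L @ c # R"] by simp
  moreover have "set (rev R @ c # L) = set (rev L @ c # R)" by auto
  ultimately show ?thesis using conn_branched_minus_end[of R c L t] t L by auto
qed

text \<open>The path \<open>P\<close> reads \<open>\<dots>, s', r, s, q, c, R\<close>, so \<open>L\<close> lists the vertices beyond \<open>q\<close> starting from
  \<open>c\<close>; \<open>su\<close>, \<open>sv\<close>, \<open>st\<close> prolong its two ends and \<open>t\<close>. The chord from \<open>h\<close> to \<open>s\<close> bypasses \<open>q\<close>, and the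
  position of \<open>s'\<close> relative to \<open>c\<close>, \<open>s\<close>, \<open>sh\<close> forces another chord, which bypasses \<open>s\<close>.\<close>

lemma no_short_chord:
  fixes L R :: "'a list" and q c t su sv st h sh :: 'a
  defines "P \<equiv> rev (q # L) @ c # R"
  defines "W \<equiv> insert t (set P)"
  defines "s \<equiv> hd (L @ [su])"
  assumes P: "xpath P" and longest: "\<And>p. xpath p \<Longrightarrow> length p \<le> length P"
    and t: "t \<in> X" "t \<notin> set P" "E t c" and R: "R \<noteq> []"
    and su: "tail_vertex W (last (q # L)) su" and sv: "tail_vertex W (last R) sv" and st: "tail_vertex W t st"
    and h: "h = t \<and> sh = st \<or> h = hd R \<and> sh = hd (tl R @ [sv])"
    and hs: "E h s"
    and btw: "pos c < pos s \<and> pos s < pos sh \<or> pos sh < pos s \<and> pos s < pos c"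
  shows False
proof -
  have P': "distinct P" "set P \<subseteq> X" "successively E (q # L)" "successively E (c # R)" "E q c"
  proof -
    show "distinct P" "set P \<subseteq> X" using P unfolding xpath_def by auto
    have *: "successively E (rev (q # L) @ c # R)" using P unfolding xpath_def P_def by blast
    then show "successively E (c # R)" "E q c"
      using successively_append_iff[of E "rev (q # L)" "c # R"] by auto
    have "successively E (rev (q # L))"
      using * successively_append_iff[of E "rev (q # L)" "c # R"] by blast
    then show "successively E (q # L)"
      by (simp only: successively_rev successively_flip)
  qed
  have WX: "W \<subseteq> X" using P' t W_def by auto
  have nh: "h \<in> W" "h \<notin> set (q # L)" "h \<noteq> c" "E h c"
  proof -
    have "hd R \<in> set R" "E c (hd R)" using R P'(4) by (auto simp: successively_Cons)
    then show "h \<in> W" "h \<notin> set (q # L)" "h \<noteq> c" "E h c"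
      using h P'(1) t E_sym[of c "hd R"] unfolding W_def P_def by auto
  qed
  \<comment> \<open>Otherwise \<open>s\<close> is the tail \<open>su\<close>, whose only neighbour
    in \<open>W\<close> is \<open>q\<close>, while \<open>h\<close> differs from
    \<open>q\<close>.\<close>
  have "L \<noteq> []"
  proof
    assume "L = []"
    then have "E su h" using hs E_sym s_def by simp
    then have "h = q" using su nh(1) \<open>L = []\<close> unfolding tail_vertex_def by auto
    then show False using nh by simp
  qed
  then have L: "L = s # tl L" unfolding s_def by simp
  \<comment> \<open>Otherwise the chord meets the end \<open>s\<close> of \<open>P\<close>, and
    rerouting along it takes in \<open>t\<close> as well, giving a path longer than
    \<open>P\<close>.\<close>
  have "tl L \<noteq> []"
  proof
    assume "tl L = []"
    then have L: "L = [s]" using L by simp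
    have Pq: "P = s # q # c # R" using L P_def by simp
    have d: "distinct (t # s # q # c # R)" "{t, s, q, c} \<union> set R \<subseteq> X"
      using P' t unfolding Pq by auto
    have e: "E q s" "E s q" "E t c" "E c q" using P' L t E_sym by auto
    show False
    proof (cases "h = t")
      case True
      have "xpath (q # s # t # c # R)"
        using d e P' hs True E_sym unfolding xpath_def by auto
      then show False using longest unfolding Pq by fastforce
    next
      case False
      then have "h = hd R" using h by blast
      moreover have "successively E R" using P'(4) R by (auto simp: successively_Cons)
      ultimately have "xpath (t # c # q # s # R)"
        using d e hs E_sym[of h s] unfolding xpath_def by (auto simp: successively_Cons)
      then show False using longest unfolding Pq by fastforce
    qed
  qed
  then obtain r M where L: "L = s # r # M" using L by (metis list.exhaust_sel)
  \<comment> \<open>The vertex after \<open>r\<close>, or the tail \<open>su\<close> if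
    \<open>r\<close> is the end of \<open>P\<close>.\<close>
  define s' where "s' = hd (M @ [su])"
  have Pe: "P = rev M @ r # s # q # c # R" using L P_def by simp
  have E1: "E q s" "E s r" "successively E (r # M)" "E h s" "E q c" "E r s"
    using P' L hs E_sym[of s r] by auto
  have Er: "E r s'"
    using E1(3) su E_sym[of su r] unfolding s'_def tail_vertex_def W_def Pe L
    by (cases M) auto
  have W: "W = {t, s, q, c, r} \<union> set M \<union> set R" unfolding W_def Pe by auto
  have dist: "distinct (t # s # q # c # r # M @ R)"
    using P'(1) t(2) unfolding Pe by auto
  have cR: "conn (insert t (set (c # R)))"
    using conn_insert[OF conn_path[OF P'(4)], of c t] t(3) E_sym by auto
  \<comment> \<open>The chord from \<open>h\<close> to \<open>s\<close> reconnects the two pieces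
    left by deleting \<open>q\<close>.\<close>
  have nc_q: "conn (W - {q})"
  proof -
    have "W - {q} = set (s # r # M) \<union> insert t (set (c # R))"
      unfolding W using dist by auto
    moreover have "h \<in> insert t (set (c # R))" using h R by auto
    ultimately show ?thesis
      using conn_Un[OF conn_path cR, of "s # r # M" s h] E1 E_sym[OF hs] by simp
  qed
  have nc_s: "conn (W - {s})" if ab: "a \<in> set (r # M)" "b \<in> {t, q, c} \<union> set R" "E a b" for a b
  proof -
    have "conn (insert q (insert t (set (c # R))))"
      using conn_insert[OF cR, of c q] E_sym[OF E1(5)] by simp
    moreover have "W - {s} = set (r # M) \<union> insert q (insert t (set (c # R)))"
      unfolding W using dist by auto
    ultimately show ?thesis
      using conn_Un[OF conn_path[OF E1(3)], of "insert q (insert t (set (c # R)))" a b] ab by auto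
  qed
  let ?u = "last (q # L)" and ?v = "last R"
  have uv: "?u \<in> set (r # M)" "?v \<in> set R" using L R by auto
  have nc: "conn (W - {?u})" "conn (W - {?v})" "conn (W - {t})"
    using conn_branched_minus_other_end[of "q # L" c R t] conn_branched_minus_end[of "q # L" c R t]
      P t R conn_path[of P] unfolding W_def P_def xpath_def by auto
  have ends_ne: "?u \<noteq> ?v" "?u \<notin> {t, q, s}" "?v \<notin> {t, q, s}" "t \<noteq> q" "t \<noteq> s" "q \<noteq> s"
    using uv dist by auto
  then have "card {?u, ?v, t} = 3" by (simp del: last.simps)
  then have c3: "3 \<le> card noncut"
    using card_noncut_subgraph_le[OF WX, of "{?u, ?v, t}"] nc uv unfolding W by fastforce
  \<comment> \<open>Otherwise both ends, \<open>t\<close>, \<open>q\<close> and \<open>s\<close> are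
    five non-cut vertices of \<open>W\<close>, so \<open>X\<close> has at least five. Hence no edge
    bypasses \<open>s\<close>.\<close>
  have not_nc_s: "\<not> conn (W - {s})"
  proof
    assume "conn (W - {s})"
    then have "card {?u, ?v, t, q, s} \<le> card noncut"
      using card_noncut_subgraph_le[OF WX, of "{?u, ?v, t, q, s}"] nc nc_q uv unfolding W by fastforce
    moreover have "card {?u, ?v, t, q, s} = 5" using ends_ne by (simp del: last.simps)
    ultimately show False using card_noncut_le by simp
  qed
  have no_edge: "\<not> E a b" if "a \<in> set (r # M)" "b \<in> {t, q, c} \<union> set R" for a b
    using nc_s[OF that] not_nc_s by blast
  have no_edge_su: "\<not> E su b" if "b \<in> {t, s, q, c} \<union> set R" for b
    using su that uv(1) dist unfolding tail_vertex_def W by auto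
  have no_edge_s': "\<not> E s' b" if "b \<in> {t, q, c} \<union> set R" for b
    using no_edge[OF _ that, of s'] no_edge_su[of b] that unfolding s'_def by (cases M) auto
  have hR: "h \<in> {t, q, c} \<union> set R" using h R by auto
  \<comment> \<open>\<open>sh\<close> is one of the tails \<open>st\<close>, \<open>sv\<close> or a
    vertex of \<open>R\<close>, and \<open>r\<close> is adjacent to none of these.\<close>
  have no_rsh: "\<not> E r sh"
  proof
    assume rsh: "E r sh"
    then have "sh = sv \<or> sh \<in> set R \<or> sh = st" using h R by (cases R; cases "tl R") auto
    then show False
      using rsh no_edge[of r sh] st sv uv E_sym[OF rsh] dist unfolding tail_vertex_def W by auto
  qed
  let ?XX = "X \<union> priv ` noncut"
  have XV: "?XX \<subseteq> V" using X_sub priv(1) by blast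
  have inX: "c \<in> X" "s \<in> X" "q \<in> X" "r \<in> X" "h \<in> X" using WX nh(1) unfolding W by auto
  have "s' \<in> ?XX" using su WX unfolding s'_def tail_vertex_def W by (cases M) auto
  have "sh \<in> ?XX" using h R st sv WX unfolding tail_vertex_def W by (cases R; cases "tl R") auto
  have "E h sh"
  proof -
    have "E t st" using st E_sym[of st t] unfolding tail_vertex_def W by blast
    moreover have "E (hd R) (hd (tl R @ [sv]))"
      using P'(4) R sv E_sym[of sv "last R"] uv(2) unfolding tail_vertex_def W
      by (cases R; cases "tl R") auto
    ultimately show ?thesis using h by blast
  qed
  have BT: "E x z" if "x \<in> X" "E x a" "E x b" "a \<in> ?XX" "b \<in> ?XX" "z \<in> ?XX"
      "pos a < pos z \<and> pos z < pos b \<or> pos b < pos z \<and> pos z < pos a" for x a b z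
    using strictly_between_adjacent[OF c3 that(1), of a b z]
      strictly_between_adjacent[OF c3 that(1), of b a z] that XV by blast
  have eq: "x = z" if "pos x = pos z" "x \<in> ?XX" "z \<in> ?XX" for x z
    using inj_onD[OF pos_inj that(1)] that XV by blast
  have ne: "pos s' \<noteq> pos c" "pos s' \<noteq> pos s" "pos s' \<noteq> pos sh"
  proof -
    show "pos s' \<noteq> pos c"
      using eq[of s' c] \<open>s' \<in> ?XX\<close> inX no_edge_s'[of q] E_sym[OF E1(5)] by auto
    show "pos s' \<noteq> pos s"
      using eq[of s' s] \<open>s' \<in> ?XX\<close> inX no_edge_s'[of q] E_sym[OF E1(1)] by auto
    show "pos s' \<noteq> pos sh"
      using eq[of s' sh] \<open>s' \<in> ?XX\<close> \<open>sh \<in> ?XX\<close> no_edge_s'[OF hR] E_sym[OF \<open>E h sh\<close>] by auto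
  qed
  \<comment> \<open>No place is left for \<open>s'\<close>. Say \<open>c\<close>, \<open>s\<close>,
    \<open>sh\<close> come in this order: beyond \<open>sh\<close> is excluded by \<open>1\<close>,
    between \<open>s\<close> and \<open>sh\<close> by \<open>2\<close>, between \<open>c\<close> and
    \<open>s\<close> by \<open>3\<close>, before \<open>c\<close> by \<open>4\<close>. Each time
    some vertex (\<open>r\<close>, \<open>h\<close>, \<open>q\<close>, \<open>r\<close>) is adjacent
    to the outer two but not to the middle one.\<close>
  have 1: "\<not> (pos s < pos sh \<and> pos sh < pos s' \<or> pos s' < pos sh \<and> pos sh < pos s)"
    using BT[of r s s' sh] Er E1 inX \<open>s' \<in> ?XX\<close> \<open>sh \<in> ?XX\<close> no_rsh by blast
  have 2: "\<not> (pos s < pos s' \<and> pos s' < pos sh \<or> pos sh < pos s' \<and> pos s' < pos s)"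
    using BT[of h s sh s'] \<open>E h sh\<close> hs inX \<open>s' \<in> ?XX\<close> \<open>sh \<in> ?XX\<close> no_edge_s'[OF hR] E_sym[of h s'] by blast
  have 3: "\<not> (pos c < pos s' \<and> pos s' < pos s \<or> pos s < pos s' \<and> pos s' < pos c)"
    using BT[of q c s s'] E1 inX \<open>s' \<in> ?XX\<close> no_edge_s'[of q] E_sym[of q s'] by blast
  have 4: "\<not> (pos s' < pos c \<and> pos c < pos s \<or> pos s < pos c \<and> pos c < pos s')"
    using BT[of r s' s c] Er E1 inX \<open>s' \<in> ?XX\<close> no_edge[of r c] by auto
  show False using 1 2 3 4 ne btw by linarith
qed


lemma longest_path_covers:
  assumes P: "xpath P" and longest: "\<And>p. xpath p \<Longrightarrow> length p \<le> length P"
    and ne: "P \<noteq> []"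
  shows "set P = X"
proof (rule ccontr)
  assume "set P \<noteq> X"
  have "\<exists>c\<in>set P. \<exists>t\<in>X - set P. E c t"
  proof (rule ccontr)
    assume "\<not> ?thesis"
    then have "set P = X"
      using connD[OF X_conn, of "set P"] P ne unfolding xpath_def by auto
    then show False using \<open>set P \<noteq> X\<close> by blast
  qed
  then obtain c t where ct: "c \<in> set P" "t \<in> X" "t \<notin> set P" "E c t" by blast
  have tc: "E t c" using ct(4) E_sym by blast
  obtain L0 R where "P = L0 @ c # R" using ct(1) by (auto dest: split_list)
  then obtain L where PL: "P = rev L @ c # R" by (metis rev_rev_ident)
  have Prev: "rev P = rev R @ c # L" using PL by simp
  have xr: "xpath (rev P)" using P xpath_rev by simp
  \<comment> \<open>At an end of \<open>P\<close> the path could be prolonged by \<open>t\<close>;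
    stated for arbitrary arms so that it applies to \<open>rev P\<close> too.\<close>
  have no_end: "R \<noteq> []" if "xpath (rev L @ c # R)" "length (rev L @ c # R) = length P"
      "set (rev L @ c # R) = set P" for L R
  proof
    assume R: "R = []"
    have "xpath ((rev L @ [c]) @ [t])"
      using that(1,3) ct unfolding R xpath_def
      by (subst successively_append_iff) auto
    then show False using longest that(2) R by fastforce
  qed
  have "R \<noteq> []" using no_end[of L R] P PL by simp
  moreover have "L \<noteq> []" using no_end[of R L] xr Prev by (metis length_rev set_rev)
  ultimately obtain q L' q2 R' where L: "L = q # L'" and R: "R = q2 # R'" by (metis list.exhaust)
  define W where "W = insert t (set P)"
  have W: "W = {t, q, c, q2} \<union> set L' \<union> set R'" unfolding W_def PL L R by auto
  have WX: "W \<subseteq> X" using P ct(2) unfolding W_def xpath_def by auto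
  have dist: "distinct (t # q # c # q2 # L' @ R')"
    using P ct(3) unfolding PL L R xpath_def by auto
  have nc: "conn (W - {last L})" "conn (W - {last R})" "conn (W - {t})"
    using conn_branched_minus_other_end[of L c R t] conn_branched_minus_end[of L c R t]
      P ct(3) tc L R conn_path[of P] unfolding W_def PL xpath_def by auto
  have uv: "last L \<in> set (q # L')" "last R \<in> set (q2 # R')" unfolding L R by auto
  have ends_ne: "last L \<noteq> last R" "last L \<noteq> t" "last R \<noteq> t" using uv dist by auto
  then have "card {last L, last R, t} = 3" by simp
  then have c3: "3 \<le> card noncut"
    using card_noncut_subgraph_le[OF WX, of "{last L, last R, t}"] nc uv unfolding W by fastforce
  obtain su sv st where su: "tail_vertex W (last L) su" and sv: "tail_vertex W (last R) sv" and st: "tail_vertex W t st"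
  proof -
    have "last L \<in> W" "last R \<in> W" "t \<in> W" using uv unfolding W by auto
    then show thesis
      using that tail_vertex_ex[OF WX _ nc(1)] tail_vertex_ex[OF WX _ nc(2)] tail_vertex_ex[OF WX _ nc(3)] by blast
  qed
  \<comment> \<open>With \<open>st\<close>, these are the second vertices of the three branches at
    \<open>c\<close>; a tail steps in where an arm has only one vertex.\<close>
  define s1 s2 where "s1 = hd (L' @ [su])" and "s2 = hd (R' @ [sv])"
  let ?XX = "X \<union> priv ` noncut"
  have XV: "?XX \<subseteq> V" using X_sub priv(1) by blast
  have inX: "c \<in> X" "q \<in> X" "q2 \<in> X" "t \<in> X" using WX unfolding W by auto
  have inXX: "s1 \<in> ?XX" "s2 \<in> ?XX" "st \<in> ?XX" "c \<in> ?XX"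
    using su sv st WX unfolding s1_def s2_def tail_vertex_def W by (cases L'; cases R'; auto)+
  have succ: "successively E (rev (q # L'))" "successively E (c # q2 # R')" "E q c"
    using P successively_append_iff[of E "rev (q # L')" "c # q2 # R'"] unfolding PL L R xpath_def by auto
  have "successively E (q # L')" using succ(1) by (simp only: successively_rev successively_flip)
  then have Eq: "E q s1" using su E_sym[of su q] unfolding s1_def tail_vertex_def W L by (cases L') auto
  have Eq2: "E q2 s2" "E q2 c"
    using succ(2) sv E_sym[of sv q2] E_sym[of c q2] unfolding s2_def tail_vertex_def W R by (cases R'; auto)+
  have Et: "E t st" using st E_sym[of st t] unfolding tail_vertex_def W by blast
  have sne: "su \<noteq> sv" "su \<noteq> st" "sv \<noteq> st" "su \<notin> W" "sv \<notin> W" "st \<notin> W"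
  proof -
    have "last L \<in> W" "last R \<in> W" "t \<in> W" using uv unfolding W by auto
    then show "su \<noteq> sv" "su \<noteq> st" "sv \<noteq> st" "su \<notin> W" "sv \<notin> W" "st \<notin> W"
      using su sv st ends_ne unfolding tail_vertex_def by blast+
  qed
  have "distinct [s1, s2, st, c]"
    using sne dist unfolding s1_def s2_def W by (cases L'; cases R') auto
  moreover have eq: "x = z" if "pos x = pos z" "x \<in> ?XX" "z \<in> ?XX" for x z
    using inj_onD[OF pos_inj that(1)] that XV by blast
  ultimately have pne: "pos s1 \<noteq> pos s2" "pos s1 \<noteq> pos st" "pos s2 \<noteq> pos st"
      "pos s1 \<noteq> pos c" "pos s2 \<noteq> pos c" "pos st \<noteq> pos c"
    using inXX by auto
  define btw where "btw x y z \<longleftrightarrow> pos x < pos y \<and> pos y < pos z \<or> pos z < pos y \<and> pos y < pos x" for x y z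
  have BT: "E x z" if "x \<in> X" "E x a" "E x b" "a \<in> ?XX" "b \<in> ?XX" "z \<in> ?XX" "btw a z b" for x a b z
    using strictly_between_adjacent[OF c3 that(1), of a b z]
      strictly_between_adjacent[OF c3 that(1), of b a z] that XV unfolding btw_def by blast
  have left: "\<not> (E h s1 \<and> btw c s1 sh)" if "h = t \<and> sh = st \<or> h = q2 \<and> sh = s2" for h sh
    using no_short_chord[of q L' c R t su sv st h sh] P longest ct tc su sv st that
    unfolding PL L R W_def btw_def s1_def s2_def by auto
  have right: "\<not> (E h s2 \<and> btw c s2 sh)" if "h = t \<and> sh = st \<or> h = q \<and> sh = s1" for h sh
  proof
    assume "E h s2 \<and> btw c s2 sh"
    moreover have "set (rev P) = set P" "length (rev P) = length P" by simp_all
    ultimately show False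
      using no_short_chord[of q2 R' c L t sv su st h sh] xr longest ct tc su sv st that
      unfolding Prev L R W_def btw_def s1_def s2_def by (metis (no_types, lifting) list.sel(1,3) list.distinct(1))
  qed
  have st_only: "\<not> E q st" "\<not> E q2 st"
    using st dist E_sym[of q st] E_sym[of q2 st] unfolding tail_vertex_def W by auto
  \<comment> \<open>Two of \<open>s1\<close>, \<open>s2\<close>, \<open>st\<close> lie on the same
    side of \<open>c\<close>. The first vertex of the farther one's branch is adjacent to
    \<open>c\<close> and to the farther one, hence to the nearer one: a chord excluded by
    \<open>left\<close> or \<open>right\<close>, or, if the nearer one is \<open>st\<close>, an edge
    that a tail cannot have.\<close>
  have "\<not> btw c s1 st" using left[of t st] BT[of t c st s1] inX inXX tc Et by blast
  moreover have "\<not> btw c s1 s2" using left[of q2 s2] BT[of q2 c s2 s1] inX inXX Eq2 by blast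
  moreover have "\<not> btw c s2 st" using right[of t st] BT[of t c st s2] inX inXX tc Et by blast
  moreover have "\<not> btw c s2 s1" using right[of q s1] BT[of q c s1 s2] inX inXX Eq succ(3) by blast
  moreover have "\<not> btw c st s1" using st_only BT[of q c s1 st] inX inXX Eq succ(3) by blast
  moreover have "\<not> btw c st s2" using st_only BT[of q2 c s2 st] inX inXX Eq2 by blast
  ultimately show False using pne unfolding btw_def by (metis linorder_neqE_nat)
qed

lemma spanning_path:
  assumes "X \<noteq> {}"
  obtains P where "xpath P" "set P = X" "P \<noteq> []"
proof -
  obtain x where "x \<in> X" using assms by blast
  then have x: "xpath [x]" by (simp add: xpath_def)
  have "length p < Suc (card X)" if "xpath p" for p
  proof -
    have "length p = card (set p)" "set p \<subseteq> X"
      using that distinct_card[of p] unfolding xpath_def by auto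
    then show ?thesis using card_mono[OF finite_X, of "set p"] by simp
  qed
  then obtain P where P: "xpath P" "\<And>p. xpath p \<Longrightarrow> length p \<le> length P"
    using ex_has_greatest_nat[of xpath "[x]" length] x by blast
  then have "P \<noteq> []" using x by fastforce
  then show thesis using that longest_path_covers[OF P] P by blast
qed

end

section \<open>From a smallest connected dominating set to a dominating path\<close>

lemma (in interval_adjacency) dominating_path:
  assumes conn: "conn V" and ne: "V \<noteq> {}"
  obtains P where "distinct P" "successively E P" "set P \<subseteq> V" "P \<noteq> []"
    "\<And>v. v \<in> V \<Longrightarrow> v \<in> set P \<or> (\<exists>x\<in>set P. E v x)"
proof -
  define dom where "dom X \<longleftrightarrow> X \<subseteq> V \<and> X \<noteq> {} \<and> conn X \<and> (\<forall>v\<in>V. v \<in> X \<or> (\<exists>x\<in>X. E v x))" for X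
  have "dom V" using assms unfolding dom_def by blast
  then obtain X where X: "dom X" and min: "\<And>Y. dom Y \<Longrightarrow> card X \<le> card Y"
    using ex_has_least_nat[of dom V card] by blast
  have fin: "finite X" using X finite_V finite_subset unfolding dom_def by blast
  show thesis
  proof (cases "\<exists>x. X = {x}")
    case True
    then obtain x where "X = {x}" by blast
    then show thesis using that[of "[x]"] X unfolding dom_def by auto
  next
    case False
    interpret private_neighbours V E pos X
    proof
      show "X \<subseteq> V" "conn X" using X unfolding dom_def by blast+
      fix y assume y: "y \<in> X" "conn (X - {y})"
      have "card (X - {y}) < card X" using y(1) fin by (meson card_Diff1_less)
      then have "\<not> dom (X - {y})" using min by fastforce
      moreover have "X - {y} \<noteq> {}" using False y(1) by blast
      ultimately obtain v where v: "v \<in> V" "v \<notin> X - {y}" "\<forall>x\<in>X - {y}. \<not> E v x"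
        using X y unfolding dom_def by blast
      \<comment> \<open>As \<open>X\<close> is not a singleton, \<open>y\<close> keeps a neighbour
        in \<open>X - {y}\<close>. So the undominated vertex \<open>v\<close> is not
        \<open>y\<close>; it lies outside \<open>X\<close> and sees only \<open>y\<close>.\<close>
      obtain z where "z \<in> X" "E y z"
        using conn_neighbour[of X y] X y(1) False unfolding dom_def by blast
      then have "v \<noteq> y" using v(3) E_irrefl by blast
      then have "v \<notin> X" using v(2) by blast
      moreover have "E v y" using X v \<open>v \<notin> X\<close> unfolding dom_def by blast
      ultimately show "\<exists>v\<in>V - X. \<forall>x\<in>X. E v x \<longleftrightarrow> x = y" using v by blast
    qed
    have "X \<noteq> {}" using X unfolding dom_def by blast
    then obtain P where P: "xpath P" "set P = X" "P \<noteq> []" by (rule spanning_path)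
    show thesis
    proof (rule that[of P])
      show "distinct P" "successively E P" "set P \<subseteq> V" "P \<noteq> []"
        using P X_sub unfolding xpath_def by auto
      show "v \<in> set P \<or> (\<exists>x\<in>set P. E v x)" if "v \<in> V" for v
        using X P(2) that unfolding dom_def by blast
    qed
  qed
qed

section \<open>Numerical positions, distances and the theorem\<close>

text \<open>Take \<open>pos x\<close> to be the number of vertices up to \<open>x\<close>; numerical
  positions turn betweenness into linear arithmetic.\<close>

lemma linear_order_on_rank:
  assumes fin: "finite V" and r: "linear_order_on V r"
  obtains pos :: "'a \<Rightarrow> nat" where "inj_on pos V"
    "\<And>x y. \<lbrakk>x \<in> V; y \<in> V; pos x < pos y\<rbrakk> \<Longrightarrow> (x, y) \<in> r"
proof -
  have refl: "\<And>x. x \<in> V \<Longrightarrow> (x, x) \<in> r" and tr: "trans r" and an: "antisym r" and tot: "total_on V r"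
    using r unfolding order_on_defs refl_on_def by blast+
  define pos where "pos x = card {y \<in> V. (y, x) \<in> r}" for x
  have less: "pos x < pos y" if "x \<in> V" "y \<in> V" "(x, y) \<in> r" "x \<noteq> y" for x y
  proof -
    have "{z \<in> V. (z, x) \<in> r} \<subseteq> {z \<in> V. (z, y) \<in> r}" using that(3) tr by (auto dest: transD)
    moreover have "y \<notin> {z \<in> V. (z, x) \<in> r}" using that an by (auto dest: antisymD)
    moreover have "y \<in> {z \<in> V. (z, y) \<in> r}" using that refl by auto
    ultimately show ?thesis unfolding pos_def using fin by (intro psubset_card_mono) auto
  qed
  have "inj_on pos V"
  proof (rule inj_onI, rule ccontr)
    fix x y assume "x \<in> V" "y \<in> V" "pos x = pos y" "x \<noteq> y"
    then show False using less[of x y] less[of y x] tot unfolding total_on_def by fastforce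
  qed
  moreover have "(x, y) \<in> r" if "x \<in> V" "y \<in> V" "pos x < pos y" for x y
    using less[of y x] that tot unfolding total_on_def by fastforce
  ultimately show thesis using that by blast
qed

lemma (in graph) graph_dist_le_1:
  assumes "v \<in> verts G" "v = x \<or> v \<rightarrow> x"
  shows "graph_dist G v x \<le> 1"
  using assms(2)
proof
  assume "v = x"
  then have "awalk v [] x" using assms(1) by (simp add: awalk_Nil_iff)
  from min_cost_le_walk_cost[OF this, of "\<lambda>_. 1"] show ?thesis
    unfolding graph_dist_def using order_trans[of _ 0 "1::ereal"] by (simp add: zero_ereal_def[symmetric])
next
  assume "v \<rightarrow> x"
  then obtain e where "e \<in> arcs G" "tail G e = v" "head G e = x" by auto
  then have "awalk v [e] x" by (auto simp: awalk_Cons_iff awalk_Nil_iff)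
  from min_cost_le_walk_cost[OF this, of "\<lambda>_. 1"] show ?thesis
    unfolding graph_dist_def by (simp add: one_ereal_def)
qed

lemma set_vwalk_arcs_subset_iff:
  "set (vwalk_arcs p) \<subseteq> A \<longleftrightarrow> successively (\<lambda>x y. (x, y) \<in> A) p"
  by (induction p rule: induct_list012) auto

theorem theorem6:
  fixes G :: "('a, 'b) pre_digraph"
  assumes "graph G"
    and "Digraph_Component.connected G"
    and "star_C1P G"
  shows "pe G \<le> 1"
proof -
  interpret graph G by fact
  obtain r where r: "linear_order_on (verts G) r"
    and cons: "\<And>u. u \<in> verts G \<Longrightarrow> consecutive_in (verts G) r (open_nbhd G u) \<or>
                      consecutive_in (verts G) r (closed_nbhd G u)"
    using assms(3) unfolding star_C1P_def by blast
  obtain pos :: "'a \<Rightarrow> nat" where pos: "inj_on pos (verts G)"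
    "\<And>x y. \<lbrakk>x \<in> verts G; y \<in> verts G; pos x < pos y\<rbrakk> \<Longrightarrow> (x, y) \<in> r"
    using linear_order_on_rank[OF finite_verts r] by blast
  interpret A: interval_adjacency "verts G" "\<lambda>u v. u \<rightarrow>\<^bsub>G\<^esub> v" pos
  proof
    show "finite (verts G)" by simp
    show "y \<rightarrow>\<^bsub>G\<^esub> x" if "x \<rightarrow>\<^bsub>G\<^esub> y" for x y using that sym_arcs by (meson arcs_ends_symmetric)
    show "\<not> x \<rightarrow>\<^bsub>G\<^esub> x" for x using adj_not_same by blast
    show "x \<in> verts G" if "x \<rightarrow>\<^bsub>G\<^esub> y" for x y using that by (simp add: adj_in_verts)
    show "inj_on pos (verts G)" by (rule pos(1))
    fix u x z y assume *: "u \<rightarrow>\<^bsub>G\<^esub> x" "u \<rightarrow>\<^bsub>G\<^esub> z" "y \<in> verts G" "pos x < pos y" "pos y < pos z"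
    then have V: "u \<in> verts G" "x \<in> verts G" "z \<in> verts G" by (auto simp: adj_in_verts)
    have "(x, y) \<in> r" "(y, z) \<in> r" using * V pos(2) by auto
    then show "u \<rightarrow>\<^bsub>G\<^esub> y \<or> y = u"
      using cons[OF V(1)] * V unfolding consecutive_in_def closed_nbhd_def open_nbhd_def by blast
  qed
  \<comment> \<open>\<open>connected\<close> refers to the symmetric closure, whose reachability
    agrees with that of the symmetric digraph \<open>G\<close>.\<close>
  have sc: "verts G \<noteq> {}" "\<And>u v. \<lbrakk>u \<in> verts G; v \<in> verts G\<rbrakk> \<Longrightarrow> u \<rightarrow>\<^sup>*\<^bsub>G\<^esub> v"
    using assms(2) reachable_mk_symmetric_eq[OF sym_arcs]
    unfolding connected_def strongly_connected_def by auto
  have "A.conn (verts G)"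
    unfolding A.conn_def
  proof (intro allI impI)
    fix C assume C: "C \<subseteq> verts G" "C \<noteq> {}" and cl: "\<forall>a\<in>C. \<forall>b\<in>verts G. a \<rightarrow>\<^bsub>G\<^esub> b \<longrightarrow> b \<in> C"
    obtain u where u: "u \<in> C" using C by blast
    have "v \<in> C" if "v \<in> verts G" for v
    proof -
      have "u \<rightarrow>\<^sup>*\<^bsub>G\<^esub> v" using sc(2) u C that by blast
      then show ?thesis
        by (induction rule: reachable_induct) (use u cl adj_in_verts in auto)
    qed
    then show "C = verts G" using C by blast
  qed
  then obtain P where P: "distinct P" "successively (\<lambda>u v. u \<rightarrow>\<^bsub>G\<^esub> v) P" "set P \<subseteq> verts G" "P \<noteq> []"
    and dom: "\<And>v. v \<in> verts G \<Longrightarrow> v \<in> set P \<or> (\<exists>x\<in>set P. v \<rightarrow>\<^bsub>G\<^esub> x)"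
    using A.dominating_path sc(1) by blast
  have vp: "vpath P G"
    using P unfolding vpath_def vwalk_def set_vwalk_arcs_subset_iff by blast
  have "Min (graph_dist G v ` set P) \<le> 1" if v: "v \<in> verts G" for v
  proof -
    obtain x where x: "x \<in> set P" "v = x \<or> v \<rightarrow>\<^bsub>G\<^esub> x" using dom[OF v] by blast
    have "Min (graph_dist G v ` set P) \<le> graph_dist G v x" using x(1) by simp
    then show ?thesis using graph_dist_le_1[OF v x(2)] by simp
  qed
  then have "path_ecc G P \<le> 1"
    unfolding path_ecc_def using sc(1) by (subst Max_le_iff) auto
  moreover have "pe G \<le> path_ecc G P"
    unfolding pe_def using vp finite_vpaths[OF finite_verts] by (intro Min_le) auto
  ultimately show ?thesis by simp
qed

end
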